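(* Consider a finite-horizon POMDP (with $T\ge 2$), the associated mixed-integer linear program (MILP), and the following equalities (C) in additional real variables $\mu_{s'a'soa}^t$, $2\le t\le T$: $$\sum_{s'\in\mathcal{X}_S,a'\in\mathcal{X}_A}\mu_{s'a'soa}^t=\mu_{soa}^t\quad\forall s\in\mathcal{X}_S,o\in\mathcal{X}_O,a\in\mathcal{X}_A,$$ $$\sum_{a\in\mathcal{X}_A}\mu_{s'a'soa}^t=p(o|s)\,p(s|s',a')\,\mu_{s'a'}^{t-1}\quad\forall s',s\in\mathcal{X}_S,o\in\mathcal{X}_O,a'\in\mathcal{X}_A,$$ $$\mu_{s'a'soa}^t=p(s|s',a',o)\sum_{\bar s\in\mathcal{X}_S}\mu_{s'a'\bar soa}^t\quad\forall s',s\in\mathcal{X}_S,o\in\mathcal{X}_O,a',a\in\mathcal{X}_A.$$ (i) The equalities (C) are valid for (MILP): for every such POMDP and every feasible solution $(\mu,\delta)$ of (MILP), there exist values $(\mu_{s'a'soa}^t)$ such that (C) holds for all $2\le t\le T$. (ii) There exist a POMDP and a feasible solution $(\mu,\delta)$ of the linear relaxation of (MILP) that does not satisfy (C), i.e. for which no values $(\mu_{s'a'soa}^t)$ satisfy (C) for all $2\le t\le T$.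
   Context: Notation: $[N]=\{1,\dots,N\}$. A POMDP with horizon $T$ consists of finite sets $\mathcal{X}_S$ (states), $\mathcal{X}_O$ (observations), $\mathcal{X}_A$ (actions), an initial distribution $p(s)$, emission probabilities $p(o|s)$, transition probabilities $p(s'|s,a)$ and a reward $r:\mathcal{X}_S\times\mathcal{X}_A\times\mathcal{X}_S\to\mathbb{R}$. $p(s|s',a',o)=\mathbb{P}(S_t=s\mid S_{t-1}=s',A_{t-1}=a',O_t=o)=\dfrac{p(o|s)p(s|s',a')}{\sum_{\bar s\in\mathcal{X}_S}p(o|\bar s)p(\bar s|s',a')}$ (with an arbitrary fixed value when the denominator is $0$). Policies: $\Delta=\{\delta=(\delta^t_{a|o}):\ \sum_{a}\delta^t_{a|o}=1,\ \delta^t_{a|o}\ge 0\ \forall o\in\mathcal{X}_O,a\in\mathcal{X}_A,t\in[T]\}$ and $\Delta^0=\{\delta\in\Delta:\ \delta^t_{a|o}\in\{0,1\}\ \forall o,a,t\}$. (MILP): over variables $\mu=\big((\mu_s^t)_s,(\mu_{sa}^t)_{s,a},(\mu_{soa}^t)_{s,o,a}\big)_t$ (with $\mu_s^t$ for $t\in[T+1]$ and the others for $t\in[T]$) and $\delta$, maximize $\sum_{t=1}^T\sum_{s,s'\in\mathcal{X}_S,\,a\in\mathcal{X}_A} r(s,a,s')\,p(s'|s,a)\,\mu_{sa}^t$ subject to, for all $s,s'\in\mathcal{X}_S$, $o\in\mathcal{X}_O$, $a\in\mathcal{X}_A$, $t\in[T]$: - $\mu_s^1=p(s)$; - $\mu_{s'}^{t+1}=\sum_{s\in\mathcal{X}_S,a\in\mathcal{X}_A}p(s'|s,a)\mu_{sa}^t$;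 - $\mu_{sa}^t=\sum_{o\in\mathcal{X}_O}\mu_{soa}^t$; - $\mu_{soa}^t\le p(o|s)\mu_s^t$; - $\mu_{soa}^t\le\delta^t_{a|o}$; - $\mu_{soa}^t\ge p(o|s)(\mu_s^t+\delta^t_{a|o}-1)$; - $\delta\in\Delta^0$; - $\mu\ge 0$. The linear relaxation of (MILP) is obtained by replacing $\delta\in\Delta^0$ by $\delta\in\Delta$. *)

theory Defs
  imports Complex_Main
begin

record ('s, 'o, 'a) pomdp =
  horizon :: nat
  states :: "'s set"
  observations :: "'o set"
  actions :: "'a set"
  init :: "'s \<Rightarrow> real"
  emission :: "'s \<Rightarrow> 'o \<Rightarrow> real"  \<comment> \<open>\<open>emission P s ob\<close> is $p(ob | s)$\<close>
  transition :: "'s \<Rightarrow> 'a \<Rightarrow> 's \<Rightarrow> real"  \<comment> \<open>\<open>transition P s a s'\<close> is $p(s' | s, a)$\<close>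
  reward :: "'s \<Rightarrow> 'a \<Rightarrow> 's \<Rightarrow> real"

definition wf_pomdp :: "('s, 'o, 'a) pomdp \<Rightarrow> bool" where
  "wf_pomdp P \<longleftrightarrow>
     finite (states P) \<and> finite (observations P) \<and> finite (actions P) \<and>
     (\<forall>s\<in>states P. init P s \<ge> 0) \<and> (\<Sum>s\<in>states P. init P s) = 1 \<and>
     (\<forall>s\<in>states P. (\<forall>ob\<in>observations P. emission P s ob \<ge> 0) \<and>
        (\<Sum>ob\<in>observations P. emission P s ob) = 1) \<and>
     (\<forall>s\<in>states P. \<forall>a\<in>actions P. (\<forall>s'\<in>states P. transition P s a s' \<ge> 0) \<and>
        (\<Sum>s'\<in>states P. transition P s a s') = 1)"

text \<open>
  \<open>belief P d s s' a' ob\<close> is $p(s | s', a', ob)$, the probability of the current state \<open>s\<close> given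
  the previous state \<open>s'\<close>, the previous action \<open>a'\<close> and the current observation \<open>ob\<close>.
  The parameter \<open>d\<close> supplies the arbitrary values used when the conditioning event has
  probability zero.
\<close>

definition belief ::
  "('s, 'o, 'a) pomdp \<Rightarrow> ('s \<Rightarrow> 's \<Rightarrow> 'a \<Rightarrow> 'o \<Rightarrow> real) \<Rightarrow> 's \<Rightarrow> 's \<Rightarrow> 'a \<Rightarrow> 'o \<Rightarrow> real" where
  "belief P d s s' a' ob =
     (let Z = \<Sum>r\<in>states P. emission P r ob * transition P s' a' r
      in if Z = 0 then d s s' a' ob else emission P s ob * transition P s' a' s / Z)"

text \<open>A policy \<open>\<delta>\<close> is indexed as \<open>\<delta> t ob a\<close>, for $\delta^t_{a | ob}$.\<close>

definition policies :: "('s, 'o, 'a) pomdp \<Rightarrow> (nat \<Rightarrow> 'o \<Rightarrow> 'a \<Rightarrow> real) set" where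
  "policies P = {\<delta>. \<forall>t\<in>{1..horizon P}. \<forall>ob\<in>observations P.
     (\<Sum>a\<in>actions P. \<delta> t ob a) = 1 \<and> (\<forall>a\<in>actions P. \<delta> t ob a \<ge> 0)}"

definition det_policies :: "('s, 'o, 'a) pomdp \<Rightarrow> (nat \<Rightarrow> 'o \<Rightarrow> 'a \<Rightarrow> real) set" where
  "det_policies P = {\<delta> \<in> policies P. \<forall>t\<in>{1..horizon P}. \<forall>ob\<in>observations P. \<forall>a\<in>actions P.
     \<delta> t ob a \<in> {0, 1}}"

record ('s, 'o, 'a) moments =
  mu_s :: "nat \<Rightarrow> 's \<Rightarrow> real"
  mu_sa :: "nat \<Rightarrow> 's \<Rightarrow> 'a \<Rightarrow> real"
  mu_soa :: "nat \<Rightarrow> 's \<Rightarrow> 'o \<Rightarrow> 'a \<Rightarrow> real"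

text \<open>
  The constraints of the program over a given set \<open>D\<close> of policies. Only the components with
  \<open>t \<in> {1..T}\<close> (for \<open>mu_s\<close>: \<open>t \<in> {1..T + 1}\<close>) and indices in the carrier sets are decision
  variables; all other values of the functions are unconstrained junk.
\<close>

definition constraints ::
  "('s, 'o, 'a) pomdp \<Rightarrow> (nat \<Rightarrow> 'o \<Rightarrow> 'a \<Rightarrow> real) set \<Rightarrow>
   ('s, 'o, 'a) moments \<Rightarrow> (nat \<Rightarrow> 'o \<Rightarrow> 'a \<Rightarrow> real) \<Rightarrow> bool" where
  "constraints P D \<mu> \<delta> \<longleftrightarrow>
     (\<forall>s\<in>states P. mu_s \<mu> 1 s = init P s) \<and>
     (\<forall>t\<in>{1..horizon P}. \<forall>s'\<in>states P.
        mu_s \<mu> (t + 1) s' =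
          (\<Sum>s\<in>states P. \<Sum>a\<in>actions P. transition P s a s' * mu_sa \<mu> t s a)) \<and>
     (\<forall>t\<in>{1..horizon P}. \<forall>s\<in>states P. \<forall>a\<in>actions P.
        mu_sa \<mu> t s a = (\<Sum>ob\<in>observations P. mu_soa \<mu> t s ob a)) \<and>
     (\<forall>t\<in>{1..horizon P}. \<forall>s\<in>states P. \<forall>ob\<in>observations P. \<forall>a\<in>actions P.
        mu_soa \<mu> t s ob a \<le> emission P s ob * mu_s \<mu> t s \<and>
        mu_soa \<mu> t s ob a \<le> \<delta> t ob a \<and>
        mu_soa \<mu> t s ob a \<ge> emission P s ob * (mu_s \<mu> t s + \<delta> t ob a - 1)) \<and>
     \<delta> \<in> D \<and>
     (\<forall>t\<in>{1..horizon P + 1}. \<forall>s\<in>states P. mu_s \<mu> t s \<ge> 0) \<and>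
     (\<forall>t\<in>{1..horizon P}. \<forall>s\<in>states P. \<forall>a\<in>actions P. mu_sa \<mu> t s a \<ge> 0) \<and>
     (\<forall>t\<in>{1..horizon P}. \<forall>s\<in>states P. \<forall>ob\<in>observations P. \<forall>a\<in>actions P.
        mu_soa \<mu> t s ob a \<ge> 0)"

definition milp_feasible ::
  "('s, 'o, 'a) pomdp \<Rightarrow> ('s, 'o, 'a) moments \<Rightarrow> (nat \<Rightarrow> 'o \<Rightarrow> 'a \<Rightarrow> real) \<Rightarrow> bool" where
  "milp_feasible P \<mu> \<delta> \<longleftrightarrow> constraints P (det_policies P) \<mu> \<delta>"

definition relaxation_feasible ::
  "('s, 'o, 'a) pomdp \<Rightarrow> ('s, 'o, 'a) moments \<Rightarrow> (nat \<Rightarrow> 'o \<Rightarrow> 'a \<Rightarrow> real) \<Rightarrow> bool" where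
  "relaxation_feasible P \<mu> \<delta> \<longleftrightarrow> constraints P (policies P) \<mu> \<delta>"

text \<open>The function maximised by the program; feasibility does not depend on it.\<close>

definition objective :: "('s, 'o, 'a) pomdp \<Rightarrow> ('s, 'o, 'a) moments \<Rightarrow> real" where
  "objective P \<mu> =
     (\<Sum>t = 1..horizon P. \<Sum>s\<in>states P. \<Sum>s'\<in>states P. \<Sum>a\<in>actions P.
        reward P s a s' * transition P s a s' * mu_sa \<mu> t s a)"

text \<open>
  The equalities (C) at time \<open>t\<close>. The additional variables are indexed as \<open>\<nu> t s' a' s ob a\<close>,
  where \<open>s', a'\<close> are the state and action at time \<open>t - 1\<close>; they are not required to be
  nonnegative.
\<close>

definition equalities_C ::
  "('s, 'o, 'a) pomdp \<Rightarrow> ('s \<Rightarrow> 's \<Rightarrow> 'a \<Rightarrow> 'o \<Rightarrow> real) \<Rightarrow> ('s, 'o, 'a) moments \<Rightarrow>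
   (nat \<Rightarrow> 's \<Rightarrow> 'a \<Rightarrow> 's \<Rightarrow> 'o \<Rightarrow> 'a \<Rightarrow> real) \<Rightarrow> nat \<Rightarrow> bool" where
  "equalities_C P d \<mu> \<nu> t \<longleftrightarrow>
     (\<forall>s\<in>states P. \<forall>ob\<in>observations P. \<forall>a\<in>actions P.
        (\<Sum>s'\<in>states P. \<Sum>a'\<in>actions P. \<nu> t s' a' s ob a) = mu_soa \<mu> t s ob a) \<and>
     (\<forall>s'\<in>states P. \<forall>s\<in>states P. \<forall>ob\<in>observations P. \<forall>a'\<in>actions P.
        (\<Sum>a\<in>actions P. \<nu> t s' a' s ob a) =
          emission P s ob * transition P s' a' s * mu_sa \<mu> (t - 1) s' a') \<and>
     (\<forall>s'\<in>states P. \<forall>s\<in>states P. \<forall>ob\<in>observations P. \<forall>a'\<in>actions P. \<forall>a\<in>actions P.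
        \<nu> t s' a' s ob a =
          belief P d s s' a' ob * (\<Sum>r\<in>states P. \<nu> t s' a' r ob a))"

end

theory Submission
  imports Defs
begin

text \<open>
  When \<open>\<delta>\<close> is deterministic, the three McCormick inequalities are exact: they force
  $\mu^t_{soa} = \delta^t_{a | o}\, p(o | s)\, \mu^t_s$ (\<open>milp_mu_soa_eq\<close>). So $\mu$ consists of the
  marginals of the process that \<open>\<delta>\<close> really generates, and the joint law
  $\delta^t_{a | o}\, p(o | s)\, p(s | s', a')\, \mu^{t-1}_{s'a'}$ of two consecutive steps solves (C).
  The third equality of (C) is then Bayes' rule: the action \<open>a\<close> sees only the observation, so it
  carries no information on \<open>s\<close> beyond $(s', a', o)$.

  For a fractional policy the McCormick inequalities leave slack, and the relaxation lets the action
  depend on the hidden state. In the \<open>blind_pomdp\<close> the state is a fresh fair coin flip at each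
  step and the only observation reveals nothing, yet the uniform policy is compatible with moments
  in which the action always equals the state. In (C), the third equality says that
  knowing $(s', a', o)$ the state is independent of the action, which makes
  $\mu^t_{soa}$ the same for both states.
\<close>

lemma mccormick_exact:
  fixes \<delta> x e m :: real
  assumes "\<delta> \<in> {0, 1}" "x \<le> e * m" "x \<le> \<delta>" "x \<ge> e * (m + \<delta> - 1)" "x \<ge> 0"
  shows "x = \<delta> * (e * m)"
  using assms by auto

lemma milp_mu_soa_eq:
  assumes "milp_feasible P \<mu> \<delta>" "t \<in> {1..horizon P}"
    and "s \<in> states P" "ob \<in> observations P" "a \<in> actions P"
  shows "mu_soa \<mu> t s ob a = \<delta> t ob a * (emission P s ob * mu_s \<mu> t s)"
  by (rule mccormick_exact)
    (use assms in \<open>auto simp: milp_feasible_def constraints_def det_policies_def\<close>)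

text \<open>
  Bayes' rule without division. When the normalising constant is zero, all summands vanish, so the
  default value \<open>d\<close> is multiplied by zero.
\<close>

lemma belief_times_normaliser:
  assumes "wf_pomdp P" "s \<in> states P" "s' \<in> states P" "a' \<in> actions P" "ob \<in> observations P"
  shows "belief P d s s' a' ob * (\<Sum>r\<in>states P. emission P r ob * transition P s' a' r)
       = emission P s ob * transition P s' a' s"
proof (cases "(\<Sum>r\<in>states P. emission P r ob * transition P s' a' r) = 0")
  case True
  have "\<forall>r\<in>states P. emission P r ob * transition P s' a' r = 0"
    using True assms by (subst (asm) sum_nonneg_eq_0_iff) (auto simp: wf_pomdp_def)
  then show ?thesis using True assms by simp
next
  case False
  then show ?thesis by (simp add: belief_def Let_def)
qed

definition two_step_law ::
  "('s, 'o, 'a) pomdp \<Rightarrow> ('s, 'o, 'a) moments \<Rightarrow> (nat \<Rightarrow> 'o \<Rightarrow> 'a \<Rightarrow> real) \<Rightarrow>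
   nat \<Rightarrow> 's \<Rightarrow> 'a \<Rightarrow> 's \<Rightarrow> 'o \<Rightarrow> 'a \<Rightarrow> real" where
  "two_step_law P \<mu> \<delta> t s' a' s ob a =
     \<delta> t ob a * (emission P s ob * transition P s' a' s) * mu_sa \<mu> (t - 1) s' a'"

lemma two_step_law_equalities_C:
  assumes wf: "wf_pomdp P" and feas: "milp_feasible P \<mu> \<delta>" and t: "t \<in> {2..horizon P}"
  shows "equalities_C P d \<mu> (two_step_law P \<mu> \<delta>) t"
  unfolding equalities_C_def
proof (intro conjI ballI)
  fix s ob a assume mem: "s \<in> states P" "ob \<in> observations P" "a \<in> actions P"
  \<comment> \<open>Flow conservation governs the step from \<open>t - 1\<close> to \<open>t\<close>, hence \<open>t \<ge> 2\<close>.\<close>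
  have "\<forall>u\<in>{1..horizon P}. mu_s \<mu> (u + 1) s =
      (\<Sum>s'\<in>states P. \<Sum>a'\<in>actions P. transition P s' a' s * mu_sa \<mu> u s' a')"
    using feas mem by (auto simp: milp_feasible_def constraints_def)
  then have "mu_s \<mu> (t - 1 + 1) s =
      (\<Sum>s'\<in>states P. \<Sum>a'\<in>actions P. transition P s' a' s * mu_sa \<mu> (t - 1) s' a')"
    by (rule bspec) (use t in auto)
  moreover have "t - 1 + 1 = t"
    using t by simp
  ultimately have flow: "mu_s \<mu> t s =
      (\<Sum>s'\<in>states P. \<Sum>a'\<in>actions P. transition P s' a' s * mu_sa \<mu> (t - 1) s' a')"
    by (simp only:)
  have "mu_soa \<mu> t s ob a = \<delta> t ob a * (emission P s ob * mu_s \<mu> t s)"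
    using milp_mu_soa_eq[OF feas _ mem] t by simp
  then show "(\<Sum>s'\<in>states P. \<Sum>a'\<in>actions P. two_step_law P \<mu> \<delta> t s' a' s ob a) = mu_soa \<mu> t s ob a"
    by (simp add: flow two_step_law_def sum_distrib_left mult.assoc)
next
  fix s' s ob a' assume mem: "ob \<in> observations P"
  have "(\<Sum>a\<in>actions P. \<delta> t ob a) = 1"
    using feas t mem
    by (auto simp: milp_feasible_def constraints_def det_policies_def policies_def)
  then show "(\<Sum>a\<in>actions P. two_step_law P \<mu> \<delta> t s' a' s ob a) =
      emission P s ob * transition P s' a' s * mu_sa \<mu> (t - 1) s' a'"
    by (simp add: two_step_law_def flip: sum_distrib_right)
next
  fix s' s ob a' a
  assume mem: "s' \<in> states P" "s \<in> states P" "ob \<in> observations P" "a' \<in> actions P"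
  let ?Z = "\<Sum>r\<in>states P. emission P r ob * transition P s' a' r"
  have "(\<Sum>r\<in>states P. two_step_law P \<mu> \<delta> t s' a' r ob a)
      = \<delta> t ob a * ?Z * mu_sa \<mu> (t - 1) s' a'"
    by (simp add: two_step_law_def sum_distrib_left sum_distrib_right)
  then have "belief P d s s' a' ob * (\<Sum>r\<in>states P. two_step_law P \<mu> \<delta> t s' a' r ob a)
      = \<delta> t ob a * (belief P d s s' a' ob * ?Z) * mu_sa \<mu> (t - 1) s' a'"
    by (simp only: mult_ac)
  also have "\<dots> = two_step_law P \<mu> \<delta> t s' a' s ob a"
    using belief_times_normaliser[OF wf, of s s' a' ob d] mem by (simp add: two_step_law_def)
  finally show "two_step_law P \<mu> \<delta> t s' a' s ob a =
      belief P d s s' a' ob * (\<Sum>r\<in>states P. two_step_law P \<mu> \<delta> t s' a' r ob a)" ..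
qed

definition blind_pomdp :: "(nat, nat, nat) pomdp" where
  "blind_pomdp = \<lparr>horizon = 2, states = {0, 1}, observations = {0}, actions = {0, 1},
     init = (\<lambda>s. 1/2), emission = (\<lambda>s ob. 1), transition = (\<lambda>s a s'. 1/2),
     reward = (\<lambda>s a s'. 0)\<rparr>"

definition state_revealing_moments :: "(nat, nat, nat) moments" where
  "state_revealing_moments = \<lparr>mu_s = (\<lambda>t s. 1/2), mu_sa = (\<lambda>t s a. if a = s then 1/2 else 0),
     mu_soa = (\<lambda>t s ob a. if a = s then 1/2 else 0)\<rparr>"

lemma wf_blind_pomdp: "wf_pomdp blind_pomdp"
  by (simp add: wf_pomdp_def blind_pomdp_def)

text \<open>
  The constant $1/2$ is where the slack is largest: $\mu^t_s = \delta^t_{a | o} = 1/2$ leaves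
  $\mu^t_{soa}$ free in the whole interval $[0, 1/2]$, and both ends are used.
\<close>

lemma state_revealing_relaxation_feasible:
  "relaxation_feasible blind_pomdp state_revealing_moments (\<lambda>t ob a. 1/2)"
  by (simp add: relaxation_feasible_def constraints_def policies_def blind_pomdp_def
      state_revealing_moments_def)

lemma belief_blind_pomdp: "belief blind_pomdp d s s' a' ob = 1/2"
  by (simp add: belief_def blind_pomdp_def)

text \<open>
  A constant belief makes each $\mu^t_{s'a'soa}$, and hence the sum $\mu^t_{soa}$ over
  $(s', a')$, independent of \<open>s\<close>; but the moments at \<open>a = 0\<close> are $1/2$ and $0$.
\<close>

lemma state_revealing_not_equalities_C:
  "\<not> equalities_C blind_pomdp d state_revealing_moments \<nu> t"
proof
  assume C: "equalities_C blind_pomdp d state_revealing_moments \<nu> t"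
  have carriers: "0 \<in> observations blind_pomdp" "0 \<in> actions blind_pomdp"
    "0 \<in> states blind_pomdp" "1 \<in> states blind_pomdp"
    by (simp_all add: blind_pomdp_def)
  have "\<nu> t s' a' s 0 0 = 1/2 * (\<Sum>r\<in>states blind_pomdp. \<nu> t s' a' r 0 0)"
    if "s' \<in> states blind_pomdp" "a' \<in> actions blind_pomdp" "s \<in> states blind_pomdp" for s' a' s
    using C carriers that unfolding equalities_C_def belief_blind_pomdp by blast
  from this[OF _ _ carriers(3)] this[OF _ _ carriers(4)]
  have "(\<Sum>s'\<in>states blind_pomdp. \<Sum>a'\<in>actions blind_pomdp. \<nu> t s' a' 0 0 0) =
      (\<Sum>s'\<in>states blind_pomdp. \<Sum>a'\<in>actions blind_pomdp. \<nu> t s' a' 1 0 0)"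
    by (intro sum.cong refl) (simp only:)
  moreover have "(\<Sum>s'\<in>states blind_pomdp. \<Sum>a'\<in>actions blind_pomdp. \<nu> t s' a' s 0 0) =
      mu_soa state_revealing_moments t s 0 0"
    if "s \<in> states blind_pomdp" for s
    using C carriers that unfolding equalities_C_def by blast
  ultimately show False
    using carriers by (simp add: state_revealing_moments_def)
qed

theorem proposition1:
  "(\<forall>(P :: ('s, 'o, 'a) pomdp) d \<mu> \<delta>.
      wf_pomdp P \<and> horizon P \<ge> 2 \<and> milp_feasible P \<mu> \<delta> \<longrightarrow>
      (\<exists>\<nu>. \<forall>t\<in>{2..horizon P}. equalities_C P d \<mu> \<nu> t)) \<and>
   (\<exists>(P :: (nat, nat, nat) pomdp) \<mu> \<delta>.
      wf_pomdp P \<and> horizon P \<ge> 2 \<and> relaxation_feasible P \<mu> \<delta> \<and>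
      (\<forall>d. \<not> (\<exists>\<nu>. \<forall>t\<in>{2..horizon P}. equalities_C P d \<mu> \<nu> t)))"
proof (rule conjI)
  show "\<forall>(P :: ('s, 'o, 'a) pomdp) d \<mu> \<delta>.
      wf_pomdp P \<and> horizon P \<ge> 2 \<and> milp_feasible P \<mu> \<delta> \<longrightarrow>
      (\<exists>\<nu>. \<forall>t\<in>{2..horizon P}. equalities_C P d \<mu> \<nu> t)"
    using two_step_law_equalities_C by blast
next
  have horizon: "horizon blind_pomdp = 2"
    by (simp add: blind_pomdp_def)
  have "\<forall>d. \<not> (\<exists>\<nu>. \<forall>t\<in>{2..horizon blind_pomdp}.
      equalities_C blind_pomdp d state_revealing_moments \<nu> t)"
    using state_revealing_not_equalities_C by (auto simp: horizon)
  then show "\<exists>(P :: (nat, nat, nat) pomdp) \<mu> \<delta>.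
      wf_pomdp P \<and> horizon P \<ge> 2 \<and> relaxation_feasible P \<mu> \<delta> \<and>
      (\<forall>d. \<not> (\<exists>\<nu>. \<forall>t\<in>{2..horizon P}. equalities_C P d \<mu> \<nu> t))"
    using wf_blind_pomdp state_revealing_relaxation_feasible horizon
    by (intro exI[of _ blind_pomdp] exI[of _ state_revealing_moments] exI[of _ "\<lambda>t ob a. 1/2"]) simp
qed

end
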